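(* Let $m\ge2$, $n\ge1$, $d\ge1$ be integers and let $\mathbb{T}$ be a tensor of order $m$ and dimension $n$ over $\mathbb{C}$. Then $$Tr_d(\mathbb{T})=(m-1)^{n-1}\sum_{E\in\mathbf{E}_{d,m-1}(n)}\frac{b(E)}{c(E)}\,\pi_E(\mathbb{T})\,|\mathbf{W}(E)|$$ and $$Tr_d(\mathbb{T})=(m-1)^{n-1}\sum_{E\in\mathbf{E}_{d,m-1}(n)}\overline{\pi_E(\mathbb{T})}\,|\mathbf{W}(E)|.$$
   Context: Write $[n]=\{1,\dots,n\}$. A tensor $\mathbb{T}$ of order $m$ and dimension $n$ is an array of complex entries $t_{i_1\cdots i_m}$, $i_1,\dots,i_m\in[n]$; write $t_{i\alpha}=t_{ii_2\cdots i_m}$ for $\alpha=(i_2,\dots,i_m)\in[n]^{m-1}$. Trace: let $A=(a_{ij})$ be an $n\times n$ matrix whose entries are independent variables, and for $\alpha=(s_1,\dots,s_{m-1})\in[n]^{m-1}$ put $\frac{\partial}{\partial a_{i\alpha}}=\prod_{k=1}^{m-1}\frac{\partial}{\partial a_{is_k}}$. The $d$-th order trace is $$Tr_d(\mathbb{T})=(m-1)^{n-1}\sum_{d_1+\cdots+d_n=d}\ \prod_{i=1}^n\frac{1}{(d_i(m-1))!}\Big(\sum_{y_i\in[n]^{m-1}}t_{iy_i}\frac{\partial}{\partial a_{iy_i}}\Big)^{d_i}\operatorname{tr}(A^{d(m-1)}),$$ the sum being over nonnegative integers $d_1,\dots,d_n$ with sum $d$. An arc multi-set $E$ is a multi-set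 of elements (arcs) of $[n]\times[n]$ (loops $(i,i)$ allowed); $d_E^+(i)$ and $d_E^-(i)$ are the outdegree and indegree of $i$ in $E$, i.e. the numbers (with multiplicity) of arcs of $E$ with initial, respectively terminal, vertex $i$. For positive integers $d,r$, $\mathbf{E}_{d,r}(n)$ is the set of arc multi-sets $E$ such that (1) $|E|=dr$ counted with multiplicity; (2) $d_E^+(i)=d_E^-(i)$ for all $i\in[n]$; (3) $d_E^+(i)$ is a multiple of $r$ for all $i\in[n]$. $b(E)$ is the product of the factorials of the multiplicities of the distinct arcs of $E$, and $c(E)=\prod_{i=1}^n d_E^+(i)!$. A closed walk of length $l$ is a sequence $(v_1,\dots,v_l)\in[n]^l$ (so the initial vertex is part of the data); its arc multi-set is $\{(v_1,v_2),(v_2,v_3),\dots,(v_l,v_1)\}$ with multiplicities. $\mathbf{W}(E)$ is the set of all closed walks whose arc multi-set equals $E$. $\mathcal{F}_d=\{((i_1,\alpha_1),\dots,(i_d,\alpha_d)) : 1\le i_1\le\cdots\le i_d\le n,\ \alpha_1,\dots,\alpha_d\in[n]^{m-1}\}$. For $F=((i_1,\alpha_1),\dots,(i_d,\alpha_d))\in\mathcal{F}_d$, put $\pi_F(\mathbb{T})=\prod_{j=1}^d t_{i_j\alpha_j}$, and let $E(F)$ be the multi-set union (multiplicities added) over $j=1,\dots,d$ of $\{(i_j,v_1),\dots,(i_j,v_{m-1})\}$, where $\alpha_j=(v_1,\dots,v_{m-1})$. For $E\in\mathbf{E}_{d,m-1}(n)$, $$\pi_E(\mathbb{T})=\sum_{F\in\mathcal{F}_d,\,E(F)=E}\pi_F(\mathbb{T}),\qquad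 \overline{\pi_E(\mathbb{T})}=\frac{\pi_E(\mathbb{T})}{|\{F\in\mathcal{F}_d : E(F)=E\}|},$$ so $\overline{\pi_E(\mathbb{T})}$ is the average (not a complex conjugate) of the values $\pi_F(\mathbb{T})$ over $F\in\mathcal{F}_d$ with $E(F)=E$. *)

theory Defs
  imports
    Complex_Main
    "HOL-Library.Multiset"
    "HOL-Library.FuncSet"
    "HOL-Library.Poly_Mapping"
    "Jordan_Normal_Form.Matrix"
begin

section \<open>Polynomials in the entries of a generic matrix\<close>

text \<open>
  Polynomials with complex coefficients in variables indexed by \<open>'v\<close>: a monomial is a
  finitely supported exponent function, a polynomial a finitely supported coefficient
  function on monomials.  Multiplication is the convolution product of \<open>Poly_Mapping\<close>.
\<close>

type_synonym 'v cpoly = "('v \<Rightarrow>\<^sub>0 nat) \<Rightarrow>\<^sub>0 complex"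

definition Var :: "'v \<Rightarrow> 'v cpoly" where
  "Var v = Poly_Mapping.single (Poly_Mapping.single v 1) 1"

definition Const :: "complex \<Rightarrow> 'v cpoly" where
  "Const c = Poly_Mapping.single 0 c"

text \<open>
  Subtraction of monomials is truncated, but where it truncates the exponent of \<open>v\<close>
  is 0, and so is the coefficient.
\<close>

definition pdiff :: "'v \<Rightarrow> 'v cpoly \<Rightarrow> 'v cpoly" where
  "pdiff v p = (\<Sum>\<mu>\<in>Poly_Mapping.keys p.
     Poly_Mapping.single (\<mu> - Poly_Mapping.single v 1)
       (of_nat (Poly_Mapping.lookup \<mu> v) * Poly_Mapping.lookup p \<mu>))"

definition mat_trace :: "'a::comm_monoid_add mat \<Rightarrow> 'a" where
  "mat_trace A = (\<Sum>i<dim_row A. A $$ (i, i))"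

text \<open>
  Matrices of \<open>Jordan_Normal_Form\<close> are indexed from 0, whereas all index sets here are
  \<open>{1..n}\<close>; hence the shift.
\<close>

definition generic_mat :: "nat \<Rightarrow> (nat \<times> nat) cpoly mat" where
  "generic_mat n = mat n n (\<lambda>(i, j). Var (Suc i, Suc j))"

section \<open>Tensors and their traces\<close>

text \<open>
  A tensor of order \<open>m\<close> and dimension \<open>n\<close> is represented by a function on index lists, of
  which only the values at lists of length \<open>m\<close> over \<open>{1..n}\<close> are ever used.  The entry
  \<open>t\<close> with index \<open>i \<alpha>\<close> is \<open>T (i # \<alpha>)\<close>.
\<close>

type_synonym tensor = "nat list \<Rightarrow> complex"

definition multi_indices :: "nat \<Rightarrow> nat \<Rightarrow> nat list set" where
  "multi_indices k n = {\<alpha>. length \<alpha> = k \<and> set \<alpha> \<subseteq> {1..n}}"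

definition multi_pdiff :: "nat \<Rightarrow> nat list \<Rightarrow> (nat \<times> nat) cpoly \<Rightarrow> (nat \<times> nat) cpoly" where
  "multi_pdiff i \<alpha> = foldr (\<lambda>s. pdiff (i, s)) \<alpha>"

definition row_operator ::
    "nat \<Rightarrow> nat \<Rightarrow> tensor \<Rightarrow> nat \<Rightarrow> (nat \<times> nat) cpoly \<Rightarrow> (nat \<times> nat) cpoly" where
  "row_operator m n T i p =
     (\<Sum>y\<in>multi_indices (m - 1) n. Const (T (i # y)) * multi_pdiff i y p)"

text \<open>
  The product over \<open>i\<close> of differential operators is their composition, \<open>i = 1\<close> outermost.
\<close>

definition product_operator ::
    "nat \<Rightarrow> nat \<Rightarrow> tensor \<Rightarrow> (nat \<Rightarrow> nat) \<Rightarrow> (nat \<times> nat) cpoly \<Rightarrow> (nat \<times> nat) cpoly" where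
  "product_operator m n T e =
     foldr (\<lambda>i p. Const (1 / fact (e i * (m - 1))) * (row_operator m n T i ^^ e i) p) [1..<Suc n]"

definition compositions :: "nat \<Rightarrow> nat \<Rightarrow> (nat \<Rightarrow> nat) set" where
  "compositions n d = {e \<in> {1..n} \<rightarrow>\<^sub>E UNIV. (\<Sum>i\<in>{1..n}. e i) = d}"

text \<open>
  Differential operators act on polynomials, so the trace is a polynomial by construction.
  It is a constant one, as operators of total order \<open>d * (m - 1)\<close> are applied to a form of
  that degree.  No coefficient is extracted here: an equation \<open>Tr m n d T = Const c\<close> says
  that the whole polynomial is the constant \<open>c\<close>.
\<close>

definition Tr :: "nat \<Rightarrow> nat \<Rightarrow> nat \<Rightarrow> tensor \<Rightarrow> (nat \<times> nat) cpoly" where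
  "Tr m n d T = Const (of_nat (m - 1) ^ (n - 1)) *
     (\<Sum>e\<in>compositions n d.
        product_operator m n T e (mat_trace (generic_mat n ^\<^sub>m (d * (m - 1)))))"

section \<open>Arc multi-sets and closed walks\<close>

type_synonym arcs = "(nat \<times> nat) multiset"

definition outdeg :: "arcs \<Rightarrow> nat \<Rightarrow> nat" where
  "outdeg E i = size {#a \<in># E. fst a = i#}"

definition indeg :: "arcs \<Rightarrow> nat \<Rightarrow> nat" where
  "indeg E i = size {#a \<in># E. snd a = i#}"

definition arc_multisets :: "nat \<Rightarrow> nat \<Rightarrow> nat \<Rightarrow> arcs set" where
  "arc_multisets d r n = {E. set_mset E \<subseteq> {1..n} \<times> {1..n} \<and> size E = d * r \<and>
     (\<forall>i\<in>{1..n}. outdeg E i = indeg E i) \<and> (\<forall>i\<in>{1..n}. r dvd outdeg E i)}"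

definition b_arcs :: "arcs \<Rightarrow> nat" where
  "b_arcs E = (\<Prod>a\<in>set_mset E. fact (count E a))"

definition c_arcs :: "nat \<Rightarrow> arcs \<Rightarrow> nat" where
  "c_arcs n E = (\<Prod>i\<in>{1..n}. fact (outdeg E i))"

definition walk_arcs :: "nat list \<Rightarrow> arcs" where
  "walk_arcs w = mset (zip w (rotate1 w))"

definition closed_walks :: "nat \<Rightarrow> arcs \<Rightarrow> nat list set" where
  "closed_walks n E = {w. w \<noteq> [] \<and> set w \<subseteq> {1..n} \<and> walk_arcs w = E}"

definition index_seqs :: "nat \<Rightarrow> nat \<Rightarrow> nat \<Rightarrow> (nat \<times> nat list) list set" where
  "index_seqs m n d = {F. length F = d \<and> sorted (map fst F) \<and>
     set F \<subseteq> {1..n} \<times> multi_indices (m - 1) n}"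

definition pi_seq :: "tensor \<Rightarrow> (nat \<times> nat list) list \<Rightarrow> complex" where
  "pi_seq T F = (\<Prod>(i, \<alpha>)\<leftarrow>F. T (i # \<alpha>))"

definition seq_arcs :: "(nat \<times> nat list) list \<Rightarrow> arcs" where
  "seq_arcs F = (\<Sum>(i, \<alpha>)\<leftarrow>F. mset (map (\<lambda>v. (i, v)) \<alpha>))"

definition index_seqs_of :: "nat \<Rightarrow> nat \<Rightarrow> nat \<Rightarrow> arcs \<Rightarrow> (nat \<times> nat list) list set" where
  "index_seqs_of m n d E = {F \<in> index_seqs m n d. seq_arcs F = E}"

definition pi_sum :: "nat \<Rightarrow> nat \<Rightarrow> nat \<Rightarrow> tensor \<Rightarrow> arcs \<Rightarrow> complex" where
  "pi_sum m n d T E = (\<Sum>F\<in>index_seqs_of m n d E. pi_seq T F)"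

definition pi_avg :: "nat \<Rightarrow> nat \<Rightarrow> nat \<Rightarrow> tensor \<Rightarrow> arcs \<Rightarrow> complex" where
  "pi_avg m n d T E = pi_sum m n d T E / of_nat (card (index_seqs_of m n d E))"

end

theory Submission
  imports Defs
begin

text \<open>
  The trace of \<open>A ^ l\<close> is the sum of the monomials of all closed walks of length \<open>l\<close>, and a
  differential monomial of order \<open>l\<close> with arc multi-set \<open>E\<close> maps the monomial of \<open>E\<close> to \<open>b(E)\<close> and
  every other monomial of degree \<open>l\<close> to 0; so it maps the trace to \<open>b(E) |W(E)|\<close>.  Expanding the
  product of operators gives one term for each \<open>F\<close>, with factor \<open>1 / c(E(F))\<close> because the outdegree
  of \<open>i\<close> in \<open>E(F)\<close> is \<open>d\<^sub>i (m - 1)\<close>.  If \<open>W(E)\<close> is nonempty then \<open>E\<close> is balanced, so grouping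
  by \<open>E(F)\<close> yields the first formula.  For the second one, concatenating the blocks of \<open>F\<close> shows that
  the \<open>F\<close> with \<open>E(F) = E\<close> correspond to the arrangements of \<open>E\<close> sorted by initial vertex, of which
  there are \<open>c(E) / b(E)\<close>.
\<close>

section \<open>Polynomials and partial derivatives\<close>

lemma Const_0 [simp]: "Const 0 = 0"
  by (simp add: Const_def)

lemma Const_mult: "Const a * Const b = Const (a * b)"
  by (simp add: Const_def mult_single)

lemma Const_add: "Const (a + b) = Const a + Const b"
  by (simp add: Const_def single_add)

lemma Const_sum: "Const (\<Sum>x\<in>A. f x) = (\<Sum>x\<in>A. Const (f x))"
  by (induction A rule: infinite_finite_induct) (simp_all add: Const_add)

text \<open>Different polynomials have different keys. Extending their sums to a common finite set,
  where the new terms have coefficient 0, makes them comparable.\<close>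

lemma pdiff_superset:
  assumes "finite K" "Poly_Mapping.keys p \<subseteq> K"
  shows "pdiff v p = (\<Sum>\<mu>\<in>K. Poly_Mapping.single (\<mu> - Poly_Mapping.single v 1)
       (of_nat (Poly_Mapping.lookup \<mu> v) * Poly_Mapping.lookup p \<mu>))"
  unfolding pdiff_def
  by (rule sum.mono_neutral_left) (use assms in \<open>auto simp: in_keys_iff\<close>)

lemma pdiff_add: "pdiff v (p + q) = pdiff v p + pdiff v q"
proof -
  let ?K = "Poly_Mapping.keys p \<union> Poly_Mapping.keys q"
  have "Poly_Mapping.keys (p + q) \<subseteq> ?K"
    by (rule Poly_Mapping.keys_add)
  then show ?thesis
    by (simp add: pdiff_superset[of ?K] lookup_add algebra_simps single_add sum.distrib)
qed

lemma pdiff_0 [simp]: "pdiff v 0 = 0"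
  by (simp add: pdiff_def)

lemma lookup_Const_mult: "Poly_Mapping.lookup (Const c * p) \<mu> = c * Poly_Mapping.lookup p \<mu>"
  by (simp add: Const_def mult_map_scale_conv_mult [symmetric] Poly_Mapping.map.rep_eq when_def)

lemma pdiff_Const_mult: "pdiff v (Const c * p) = Const c * pdiff v p"
proof -
  have "Poly_Mapping.keys (Const c * p) \<subseteq> Poly_Mapping.keys p"
    by (auto simp: in_keys_iff lookup_Const_mult)
  then have "pdiff v (Const c * p) =
      (\<Sum>\<mu>\<in>Poly_Mapping.keys p. Poly_Mapping.single (\<mu> - Poly_Mapping.single v 1)
       (c * (of_nat (Poly_Mapping.lookup \<mu> v) * Poly_Mapping.lookup p \<mu>)))"
    by (simp add: pdiff_superset[of "Poly_Mapping.keys p"] lookup_Const_mult mult.left_commute)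
  then show ?thesis
    by (simp add: pdiff_def sum_distrib_left Const_def mult_single)
qed

lemma pdiff_single:
  "pdiff v (Poly_Mapping.single \<mu> c) = Poly_Mapping.single (\<mu> - Poly_Mapping.single v 1)
     (of_nat (Poly_Mapping.lookup \<mu> v) * c)"
  by (subst pdiff_superset[of "{\<mu>}"]) (auto split: if_splits)

abbreviation pdiffs :: "'v list \<Rightarrow> 'v cpoly \<Rightarrow> 'v cpoly" where
  "pdiffs \<equiv> foldr pdiff"

lemma pdiffs_0 [simp]: "pdiffs xs 0 = 0"
  by (induction xs) simp_all

lemma pdiffs_add: "pdiffs xs (p + q) = pdiffs xs p + pdiffs xs q"
  by (induction xs) (simp_all add: pdiff_add)

lemma pdiffs_sum: "pdiffs xs (\<Sum>x\<in>A. f x) = (\<Sum>x\<in>A. pdiffs xs (f x))"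
  by (induction A rule: infinite_finite_induct) (simp_all add: pdiffs_add)

lemma pdiffs_Const_mult: "pdiffs xs (Const c * p) = Const c * pdiffs xs p"
  by (induction xs) (simp_all add: pdiff_Const_mult)

section \<open>Monomials indexed by multisets of variables\<close>

definition exponents :: "'v multiset \<Rightarrow> 'v \<Rightarrow>\<^sub>0 nat" where
  "exponents E = (\<Sum>a\<in>#E. Poly_Mapping.single a 1)"

lemma exponents_empty [simp]: "exponents {#} = 0"
  by (simp add: exponents_def)

lemma exponents_add_mset: "exponents (add_mset a E) = Poly_Mapping.single a 1 + exponents E"
  by (simp add: exponents_def)

lemma lookup_exponents [simp]: "Poly_Mapping.lookup (exponents E) a = count E a"
  by (induction E) (simp_all add: exponents_add_mset lookup_add lookup_single when_def)

text \<open>Both subtractions truncate at 0, so they agree also when \<open>a\<close> does not occur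
  in \<open>E\<close>.\<close>

lemma exponents_diff: "exponents (E - {#a#}) = exponents E - Poly_Mapping.single a 1"
  by (rule poly_mapping_eqI) (simp add: lookup_minus lookup_single when_def)

definition monomial :: "'v multiset \<Rightarrow> 'v cpoly" where
  "monomial E = Poly_Mapping.single (exponents E) 1"

lemma prod_list_Var: "(\<Prod>a\<leftarrow>xs. Var a) = monomial (mset xs)"
  by (induction xs) (simp_all add: monomial_def Var_def mult_single exponents_add_mset)

lemma pdiff_monomial: "pdiff a (monomial E) = Const (of_nat (count E a)) * monomial (E - {#a#})"
  by (simp add: monomial_def Const_def pdiff_single mult_single exponents_diff del: single_of_nat)

text \<open>Polymorphic form of \<open>b_arcs\<close>, as the derivative lemmas concern variables of
  any type.\<close>

definition mult_fact :: "'v multiset \<Rightarrow> nat" where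
  "mult_fact E = (\<Prod>a\<in>set_mset E. fact (count E a))"

lemma mult_fact_add_mset: "mult_fact (add_mset a E) = Suc (count E a) * mult_fact E"
proof -
  \<comment> \<open>Over the common index set \<open>insert a (set_mset E)\<close> the products for
    \<open>E\<close> and \<open>add_mset a E\<close> can be compared; an absent \<open>a\<close>
    adds only the factor \<open>fact 0\<close>.\<close>
  have sup: "mult_fact D = (\<Prod>x\<in>insert a (set_mset E). fact (count D x))"
    if "D = E \<or> D = add_mset a E" for D
    unfolding mult_fact_def
    by (rule prod.mono_neutral_left) (use that in \<open>auto simp: not_in_iff\<close>)
  have "mult_fact (add_mset a E)
      = fact (Suc (count E a)) * (\<Prod>x\<in>set_mset E - {a}. fact (count (add_mset a E) x))"
    by (subst sup) (simp_all add: prod.insert_remove)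
  also have "(\<Prod>x\<in>set_mset E - {a}. fact (count (add_mset a E) x) :: nat)
      = (\<Prod>x\<in>set_mset E - {a}. fact (count E x))"
    by (rule prod.cong) auto
  finally show ?thesis
    using sup[of E] by (simp add: prod.insert_remove algebra_simps)
qed

text \<open>Each derivative removes one copy of its variable, with the current multiplicity as a
  factor, and gives 0 if no copy is left. With as many derivatives as the degree, either a constant
  survives or nothing does.\<close>

lemma pdiffs_monomial:
  assumes "size E = length xs"
  shows "pdiffs xs (monomial E) = (if mset xs = E then Const (of_nat (mult_fact E)) else 0)"
  using assms
\<comment> \<open>\<open>foldr\<close> applies the last derivative first, hence the induction from
  the right.\<close>
proof (induction xs arbitrary: E rule: rev_induct)
  case Nil
  then show ?case by (simp add: monomial_def Const_def mult_fact_def)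
next
  case (snoc x xs)
  show ?case
  proof (cases "x \<in># E")
    case True
    then obtain D where D: "E = add_mset x D"
      by (meson mset_add)
    then show ?thesis
      using snoc by (simp add: pdiff_monomial pdiffs_Const_mult mult_fact_add_mset Const_mult distrib_right)
  next
    case False
    then have "mset (xs @ [x]) \<noteq> E"
      by auto
    then show ?thesis
      using False by (simp add: pdiff_monomial pdiffs_Const_mult not_in_iff)
  qed
qed

section \<open>Traces of matrix powers and closed walks\<close>

lemma finite_multi_indices [simp]: "finite (multi_indices k n)"
  using finite_lists_length_eq[of "{1..n}" k]
  by (simp add: multi_indices_def conj_commute)

lemma sum_multi_indices_Suc:
  "(\<Sum>w\<in>multi_indices (Suc k) n. f w) = (\<Sum>i\<in>{1..n}. \<Sum>w\<in>multi_indices k n. f (i # w))"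
proof -
  have "multi_indices (Suc k) n = (\<lambda>(i, w). i # w) ` ({1..n} \<times> multi_indices k n)"
    by (auto simp: multi_indices_def length_Suc_conv image_iff)
  moreover have "inj_on (\<lambda>(i, w). i # w) ({1..n} \<times> multi_indices k n)"
    by (auto simp: inj_on_def)
  ultimately show ?thesis
    by (simp add: sum.reindex sum.cartesian_product case_prod_unfold)
qed

text \<open>\<open>pow_mat\<close> puts the new factor on the right, so a walk grows at its end. The
  variant for Cons serves to split off the initial vertex of a closed walk.\<close>

lemma sum_multi_indices_snoc:
  "(\<Sum>w\<in>multi_indices (Suc k) n. f w) = (\<Sum>i\<in>{1..n}. \<Sum>w\<in>multi_indices k n. f (w @ [i]))"
proof -
  have "multi_indices (Suc k) n = (\<lambda>(i, w). w @ [i]) ` ({1..n} \<times> multi_indices k n)"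
    by (force simp: multi_indices_def length_Suc_conv_rev image_iff)
  moreover have "inj_on (\<lambda>(i, w). w @ [i]) ({1..n} \<times> multi_indices k n)"
    by (auto simp: inj_on_def)
  ultimately show ?thesis
    by (simp add: sum.reindex sum.cartesian_product case_prod_unfold)
qed

text \<open>Here \<open>w\<close> lists the \<open>k\<close> inner vertices of a walk of length
  \<open>Suc k\<close> from \<open>Suc i\<close> to \<open>Suc j\<close>, and the zip pairs each
  vertex with its successor. One more factor \<open>M\<close> turns the old last vertex into an
  inner one.\<close>

lemma index_pow_mat:
  fixes f :: "nat \<times> nat \<Rightarrow> 'a :: comm_semiring_1" and n :: nat
  defines "M \<equiv> mat n n (\<lambda>(i, j). f (Suc i, Suc j))"
  assumes "i < n" "j < n"
  shows "(M ^\<^sub>m Suc k) $$ (i, j) =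
    (\<Sum>w\<in>multi_indices k n. \<Prod>a\<leftarrow>zip (Suc i # w) (w @ [Suc j]). f a)"
  using assms(3)
proof (induction k arbitrary: j)
  case 0
  have "multi_indices 0 n = {[]}"
    by (auto simp: multi_indices_def)
  then show ?case
    using 0 assms(2) by (simp add: M_def)
next
  case (Suc k)
  have [simp]: "dim_row M = n" "dim_col M = n"
    by (simp_all add: M_def)
  have dims: "M ^\<^sub>m Suc k \<in> carrier_mat n n"
    by (intro pow_carrier_mat) (simp add: M_def)
  have "(M ^\<^sub>m Suc (Suc k)) $$ (i, j) = (M ^\<^sub>m Suc k * M) $$ (i, j)"
    by simp
  also have "\<dots> = (\<Sum>l<n. (M ^\<^sub>m Suc k) $$ (i, l) * M $$ (l, j))"
    using dims Suc.prems assms(2)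
    by (subst index_mult_mat)
       (auto simp: scalar_prod_def atLeast0LessThan simp del: pow_mat.simps intro!: sum.cong)
  also have "\<dots> = (\<Sum>l<n. (\<Sum>w\<in>multi_indices k n.
      \<Prod>a\<leftarrow>zip (Suc i # w) (w @ [Suc l]). f a) * f (Suc l, Suc j))"
    using Suc by (intro sum.cong) (simp_all add: M_def del: pow_mat.simps)
  also have "\<dots> = (\<Sum>l<n. \<Sum>w\<in>multi_indices k n.
      \<Prod>a\<leftarrow>zip (Suc i # w @ [Suc l]) ((w @ [Suc l]) @ [Suc j]). f a)"
    unfolding sum_distrib_right
  proof (intro sum.cong refl)
    fix l w
    have "zip (Suc i # w @ [Suc l]) ((w @ [Suc l]) @ [Suc j])
        = zip (Suc i # w) (w @ [Suc l]) @ [(Suc l, Suc j)]"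
      by (metis Cons_eq_appendI length_Cons length_append_singleton zip_Cons_Cons zip_Nil zip_append)
    then show "(\<Prod>a\<leftarrow>zip (Suc i # w) (w @ [Suc l]). f a) * f (Suc l, Suc j)
        = (\<Prod>a\<leftarrow>zip (Suc i # w @ [Suc l]) ((w @ [Suc l]) @ [Suc j]). f a)"
      by simp
  qed
  also have "\<dots> = (\<Sum>l\<in>{1..n}. \<Sum>w\<in>multi_indices k n.
      \<Prod>a\<leftarrow>zip (Suc i # w @ [l]) ((w @ [l]) @ [Suc j]). f a)"
    by (rule sum.reindex_bij_witness[of _ "\<lambda>l. l - 1" Suc]) auto
  also have "\<dots> = (\<Sum>w\<in>multi_indices (Suc k) n. \<Prod>a\<leftarrow>zip (Suc i # w) (w @ [Suc j]). f a)"
    by (simp only: sum_multi_indices_snoc)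
  finally show ?case .
qed

text \<open>Diagonal entries collect the walks that return to their start, and
  \<open>rotate1 (i # w) = w @ [i]\<close> identifies their arcs. For \<open>l = 0\<close> the
  identity matrix has trace \<open>n\<close>, whereas the empty sequence contributes 1.\<close>

lemma mat_trace_generic_mat_pow:
  assumes "l > 0"
  shows "mat_trace (generic_mat n ^\<^sub>m l) = (\<Sum>w\<in>multi_indices l n. monomial (walk_arcs w))"
proof -
  obtain k where l: "l = Suc k"
    using assms by (cases l) auto
  let ?f = "\<lambda>i w. \<Prod>a\<leftarrow>zip (i # w) (w @ [i]). Var a :: (nat \<times> nat) cpoly"
  have "dim_row (generic_mat n ^\<^sub>m l) = n"
    using pow_carrier_mat[of "generic_mat n" n l] by (simp add: generic_mat_def)
  then have "mat_trace (generic_mat n ^\<^sub>m l) = (\<Sum>i<n. (generic_mat n ^\<^sub>m l) $$ (i, i))"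
    by (simp only: mat_trace_def)
  also have "\<dots> = (\<Sum>i<n. \<Sum>w\<in>multi_indices k n. ?f (Suc i) w)"
    unfolding generic_mat_def l by (intro sum.cong refl index_pow_mat) simp_all
  also have "\<dots> = (\<Sum>i\<in>{1..n}. \<Sum>w\<in>multi_indices k n. ?f i w)"
    by (rule sum.reindex_bij_witness[of _ "\<lambda>l. l - 1" Suc]) auto
  also have "\<dots> = (\<Sum>i\<in>{1..n}. \<Sum>w\<in>multi_indices k n. monomial (walk_arcs (i # w)))"
    by (simp only: prod_list_Var walk_arcs_def rotate1.simps)
  also have "\<dots> = (\<Sum>w\<in>multi_indices l n. monomial (walk_arcs w))"
    by (simp only: l sum_multi_indices_Suc)
  finally show ?thesis .
qed

lemma size_walk_arcs [simp]: "size (walk_arcs w) = length w"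
  by (simp add: walk_arcs_def)

lemma pdiffs_trace:
  assumes "length xs > 0"
  shows "pdiffs xs (mat_trace (generic_mat n ^\<^sub>m length xs))
    = Const (of_nat (mult_fact (mset xs)) * of_nat (card (closed_walks n (mset xs))))"
proof -
  let ?l = "length xs"
  \<comment> \<open>\<open>closed_walks\<close> fixes no length, but a closed walk has as many
    vertices as arcs.\<close>
  have W: "closed_walks n (mset xs) = {w \<in> multi_indices ?l n. walk_arcs w = mset xs}"
    using assms by (auto simp: closed_walks_def multi_indices_def)
       (metis size_mset size_walk_arcs)
  have "pdiffs xs (mat_trace (generic_mat n ^\<^sub>m ?l))
      = (\<Sum>w\<in>multi_indices ?l n. pdiffs xs (monomial (walk_arcs w)))"
    using assms by (simp add: mat_trace_generic_mat_pow pdiffs_sum)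
  also have "\<dots> = (\<Sum>w\<in>multi_indices ?l n.
      if walk_arcs w = mset xs then Const (of_nat (mult_fact (mset xs))) else 0)"
    by (intro sum.cong refl) (subst pdiffs_monomial, auto simp: multi_indices_def)
  also have "\<dots> = (\<Sum>w\<in>closed_walks n (mset xs). Const (of_nat (mult_fact (mset xs))))"
    unfolding W by (rule sum.inter_filter [symmetric]) simp
  also have "\<dots> = Const (\<Sum>w\<in>closed_walks n (mset xs). of_nat (mult_fact (mset xs)))"
    by (simp only: Const_sum)
  finally show ?thesis
    by (simp add: mult.commute)
qed

section \<open>Expansion of the differential operator\<close>

text \<open>The arcs of \<open>seq_arcs\<close> kept in order: first as the list of derivatives to
  compose, later as a sorted list from which \<open>F\<close> can be recovered.\<close>

definition arc_list :: "(nat \<times> nat list) list \<Rightarrow> (nat \<times> nat) list" where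
  "arc_list F = concat (map (\<lambda>(i, \<alpha>). map (Pair i) \<alpha>) F)"

lemma arc_list_simps [simp]:
  "arc_list [] = []"
  "arc_list (x # F) = map (Pair (fst x)) (snd x) @ arc_list F"
  "arc_list (F @ G) = arc_list F @ arc_list G"
  by (simp_all add: arc_list_def case_prod_unfold)

lemma pi_seq_simps [simp]:
  "pi_seq T [] = 1"
  "pi_seq T (x # F) = T (fst x # snd x) * pi_seq T F"
  "pi_seq T (F @ G) = pi_seq T F * pi_seq T G"
  by (simp_all add: pi_seq_def case_prod_unfold)

lemma mset_arc_list: "mset (arc_list F) = seq_arcs F"
  by (induction F) (auto simp: seq_arcs_def)

lemma set_arc_list: "set (arc_list F) = (\<Union>(i, \<alpha>)\<in>set F. Pair i ` set \<alpha>)"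
  by (auto simp: arc_list_def)

lemma multi_pdiff_eq_pdiffs: "multi_pdiff i \<alpha> = pdiffs (map (Pair i) \<alpha>)"
  by (induction \<alpha>) (simp_all add: multi_pdiff_def)

text \<open>Constants pass through derivatives, so the power of the sum expands into one term for
  each sequence of \<open>k\<close> choices of a summand.\<close>

lemma row_operator_funpow:
  "(row_operator m n T i ^^ k) p =
    (\<Sum>F | length F = k \<and> set F \<subseteq> {i} \<times> multi_indices (m - 1) n.
      Const (pi_seq T F) * pdiffs (arc_list F) p)"
proof (induction k)
  case 0
  have "{F. length F = 0 \<and> set F \<subseteq> {i} \<times> multi_indices (m - 1) n} = {[]}"
    by auto
  then show ?case
    by (simp add: Const_def)
next
  case (Suc k)
  let ?M = "multi_indices (m - 1) n"
  let ?S = "\<lambda>k. {F. length F = k \<and> set F \<subseteq> {i} \<times> ?M}"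
  have S: "?S (Suc k) = (\<lambda>(y, F). (i, y) # F) ` (?M \<times> ?S k)"
    by (auto simp: length_Suc_conv image_iff)
  have inj: "inj_on (\<lambda>(y, F). (i, y) # F) (?M \<times> ?S k)"
    by (auto simp: inj_on_def)
  have "(row_operator m n T i ^^ Suc k) p = row_operator m n T i
      (\<Sum>F\<in>?S k. Const (pi_seq T F) * pdiffs (arc_list F) p)"
    using Suc.IH by simp
  also have "\<dots> = (\<Sum>y\<in>?M. \<Sum>F\<in>?S k. Const (pi_seq T ((i, y) # F)) * pdiffs (arc_list ((i, y) # F)) p)"
    by (simp add: row_operator_def multi_pdiff_eq_pdiffs pdiffs_sum pdiffs_Const_mult sum_distrib_left
        mult.assoc flip: Const_mult)
  also have "\<dots> = (\<Sum>F\<in>?S (Suc k). Const (pi_seq T F) * pdiffs (arc_list F) p)"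
    unfolding S sum.reindex[OF inj] by (simp add: sum.cartesian_product case_prod_unfold)
  finally show ?case .
qed

text \<open>In a sorted list no key \<open>i\<close> follows a larger one. This serves twice: to
  split off the first row of an index sequence, and to split off the arcs leaving the smallest
  vertex of an arc list.\<close>

lemma sorted_key_split:
  fixes xs :: "('a :: linorder \<times> 'b) list"
  assumes "sorted (map fst xs)" "\<And>x. x \<in> set xs \<Longrightarrow> i \<le> fst x"
  shows "xs = filter (\<lambda>x. fst x = i) xs @ filter (\<lambda>x. fst x \<noteq> i) xs"
  using assms
proof (induction xs)
  case (Cons x xs)
  show ?case
  proof (cases "fst x = i")
    case True
    then show ?thesis
      using Cons by auto
  next
    case False
    then have "i < fst x"
      using Cons.prems by (metis list.set_intros(1) order_le_imp_less_or_eq)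
    then have "fst y \<noteq> i" if "y \<in> set (x # xs)" for y
      using Cons.prems(1) that by auto
    then show ?thesis
      by (simp add: filter_id_conv filter_empty_conv)
  qed
qed simp

text \<open>Recovers from \<open>F\<close> the exponents d_i of the composition in whose term
  \<open>F\<close> arises.\<close>

definition row_count :: "(nat \<times> nat list) list \<Rightarrow> nat \<Rightarrow> nat" where
  "row_count F i = length (filter (\<lambda>x. fst x = i) F)"

text \<open>Keeping the list \<open>is\<close> of rows general allows an induction along the
  \<open>foldr\<close> of \<open>product_operator\<close>.\<close>

definition block_seqs :: "nat list set \<Rightarrow> (nat \<Rightarrow> nat) \<Rightarrow> nat list \<Rightarrow> (nat \<times> nat list) list set" where
  "block_seqs M e is = {F. sorted (map fst F) \<and> set F \<subseteq> set is \<times> M \<and> (\<forall>i\<in>set is. row_count F i = e i)}"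

lemma row_count_append [simp]: "row_count (F @ G) i = row_count F i + row_count G i"
  by (simp add: row_count_def)

text \<open>As \<open>i\<close> is smaller than all of \<open>is\<close>, sortedness puts the
  entries of row \<open>i\<close> first. There are exactly \<open>e i\<close> of them, so the place
  of the cut is determined.\<close>

lemma block_seqs_Cons:
  assumes "sorted_wrt (<) (i # is)"
  shows "bij_betw (\<lambda>(F, G). F @ G)
    ({F. length F = e i \<and> set F \<subseteq> {i} \<times> M} \<times> block_seqs M e is) (block_seqs M e (i # is))"
    (is "bij_betw ?f (?R \<times> _) _")
proof (rule bij_betw_imageI)
  show "inj_on ?f (?R \<times> block_seqs M e is)"
    by (auto simp: inj_on_def)
  have lt: "i < j" if "j \<in> set is" for j
    using assms that by simp
  have "F @ G \<in> block_seqs M e (i # is)" if F: "F \<in> ?R" and G: "G \<in> block_seqs M e is" for F G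
  proof -
    have fsts: "fst x = i" if "x \<in> set F" for x
      using F that by auto
    have "map fst F = map (\<lambda>_. i) F"
      using fsts by simp
    then have "sorted (map fst F)"
      by (simp add: map_replicate_const)
    moreover have "\<forall>x\<in>set F. \<forall>y\<in>set G. fst x \<le> fst y"
      using fsts G lt by (fastforce simp: block_seqs_def)
    moreover have "row_count F i = e i"
      using F fsts by (simp add: row_count_def)
    moreover have "row_count F j = 0" if "j \<in> set is" for j
      using fsts lt[OF that] by (auto simp: row_count_def filter_empty_conv)
    moreover have "row_count G i = 0"
      using G lt by (fastforce simp: row_count_def filter_empty_conv block_seqs_def)
    ultimately show ?thesis
      using F G lt by (auto simp: block_seqs_def sorted_append)
  qed
  moreover have "H \<in> ?f ` (?R \<times> block_seqs M e is)" if H: "H \<in> block_seqs M e (i # is)" for H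
  proof -
    let ?F = "filter (\<lambda>x. fst x = i) H" and ?G = "filter (\<lambda>x. fst x \<noteq> i) H"
    have sorted: "sorted (map fst H)" and sub: "set H \<subseteq> set (i # is) \<times> M"
      using H by (auto simp: block_seqs_def)
    have split: "?F @ ?G = H"
    proof (rule sorted_key_split[OF sorted, symmetric])
      show "i \<le> fst x" if "x \<in> set H" for x
        using that sub lt by (force intro: less_imp_le)
    qed
    have "?F \<in> ?R"
      using H sub by (auto simp: block_seqs_def row_count_def)
    moreover have "row_count ?G j = e j" if "j \<in> set is" for j
    proof -
      have "filter (\<lambda>x. fst x = j) ?G = filter (\<lambda>x. fst x = j) H"
        using lt[OF that] by (auto intro: filter_cong)
      then show ?thesis
        using H that by (simp add: row_count_def block_seqs_def)
    qed
    then have "?G \<in> block_seqs M e is"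
      using sorted sub by (auto simp: block_seqs_def intro: sorted_filter)
    ultimately show ?thesis
      by (intro image_eqI[of _ _ "(?F, ?G)"]) (simp_all only: prod.case split mem_Sigma_iff)
  qed
  ultimately show "?f ` (?R \<times> block_seqs M e is) = block_seqs M e (i # is)"
    by auto
qed

text \<open>A term \<open>F\<close> of row \<open>i\<close> applied to a term \<open>G\<close> of
  the later rows is the term of \<open>F @ G\<close>, and by \<open>block_seqs_Cons\<close> these
  concatenations run once through all sequences for \<open>i # is\<close>.\<close>

lemma product_operator_expansion:
  assumes "sorted_wrt (<) is"
  shows "foldr (\<lambda>i p. Const (1 / fact (e i * (m - 1))) * (row_operator m n T i ^^ e i) p) is p =
    Const (\<Prod>i\<leftarrow>is. 1 / fact (e i * (m - 1))) *
      (\<Sum>F\<in>block_seqs (multi_indices (m - 1) n) e is. Const (pi_seq T F) * pdiffs (arc_list F) p)"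
  using assms
proof (induction "is")
  case Nil
  have "block_seqs (multi_indices (m - 1) n) e [] = {[]}"
    by (auto simp: block_seqs_def)
  then show ?case
    by (simp add: Const_def)
next
  case (Cons i "is")
  let ?B = "block_seqs (multi_indices (m - 1) n) e"
  let ?R = "{F. length F = e i \<and> set F \<subseteq> {i} \<times> multi_indices (m - 1) n}"
  let ?g = "\<lambda>F. Const (pi_seq T F) * pdiffs (arc_list F) p"
  let ?c = "\<lambda>is. \<Prod>i\<leftarrow>is. 1 / fact (e i * (m - 1)) :: complex"
  have "foldr (\<lambda>i p. Const (1 / fact (e i * (m - 1))) * (row_operator m n T i ^^ e i) p) (i # is) p
      = Const (1 / fact (e i * (m - 1))) *
        (row_operator m n T i ^^ e i) (Const (?c is) * (\<Sum>G\<in>?B is. ?g G))"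
    using Cons by simp
  also have "(row_operator m n T i ^^ e i) (Const (?c is) * (\<Sum>G\<in>?B is. ?g G))
      = Const (?c is) * (\<Sum>F\<in>?R. \<Sum>G\<in>?B is. ?g (F @ G))"
    by (simp add: row_operator_funpow pdiffs_sum pdiffs_Const_mult sum_distrib_left
        mult.assoc mult.left_commute flip: Const_mult)
  also have "(\<Sum>F\<in>?R. \<Sum>G\<in>?B is. ?g (F @ G)) = (\<Sum>H\<in>?B (i # is). ?g H)"
    by (simp add: sum.reindex_bij_betw[OF block_seqs_Cons[OF Cons.prems], symmetric]
        sum.cartesian_product case_prod_unfold)
  finally show ?case
    by (simp only: list.map prod_list.Cons mult.assoc flip: Const_mult)
qed

section \<open>Counting index sequences\<close>

lemma outdeg_empty [simp]: "outdeg {#} i = 0"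
  by (simp add: outdeg_def)

lemma outdeg_add_mset [simp]: "outdeg (add_mset a E) i = (if fst a = i then 1 else 0) + outdeg E i"
  by (simp add: outdeg_def)

lemma outdeg_mset: "outdeg (mset L) i = length (filter (\<lambda>x. fst x = i) L)"
  by (simp add: outdeg_def flip: mset_filter)

section \<open>Arrangements of an arc multi-set sorted by initial vertex\<close>

definition sorted_arrangements :: "arcs \<Rightarrow> (nat \<times> nat) list set" where
  "sorted_arrangements E = {L. mset L = E \<and> sorted (map fst L)}"

lemma finite_sorted_arrangements [simp]: "finite (sorted_arrangements E)"
  by (rule finite_subset[OF _ finite_lists_length_eq[of "set_mset E" "size E"]])
     (auto simp: sorted_arrangements_def)

text \<open>Sortedness forces the first arc to leave the smallest initial vertex but leaves its
  terminal vertex free, since arcs with the same initial vertex may come in any order.\<close>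

lemma sorted_arrangements_eq:
  assumes "E \<noteq> {#}"
  defines "k \<equiv> Min (fst ` set_mset E)"
  shows "sorted_arrangements E =
    (\<Union>a\<in>{a \<in> set_mset E. fst a = k}. (#) a ` sorted_arrangements (E - {#a#}))"
proof (intro equalityI subsetI)
  fix L assume L: "L \<in> sorted_arrangements E"
  then obtain a L' where L': "L = a # L'"
    using assms(1) by (cases L) (auto simp: sorted_arrangements_def)
  have E: "E = add_mset a (mset L')"
    using L L' by (simp add: sorted_arrangements_def)
  have "fst a = k"
    unfolding k_def using L E L' by (intro Min_eqI [symmetric]) (auto simp: sorted_arrangements_def)
  moreover have "a \<in># E" "L \<in> (#) a ` sorted_arrangements (E - {#a#})"
    using L L' E by (auto simp: sorted_arrangements_def)
  ultimately show "L \<in> (\<Union>a\<in>{a \<in> set_mset E. fst a = k}. (#) a ` sorted_arrangements (E - {#a#}))"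
    by blast
next
  fix L assume "L \<in> (\<Union>a\<in>{a \<in> set_mset E. fst a = k}. (#) a ` sorted_arrangements (E - {#a#}))"
  then obtain a L' where a: "a \<in># E" "fst a = k" and L: "L = a # L'" "mset L' = E - {#a#}"
      "sorted (map fst L')"
    by (auto simp: sorted_arrangements_def)
  have "k \<le> fst x" if "x \<in> set L'" for x
  proof -
    have "x \<in># E"
      using that L(2) by (metis in_diffD set_mset_mset)
    then show ?thesis
      by (simp add: k_def)
  qed
  then show "L \<in> sorted_arrangements E"
    using a L by (auto simp: sorted_arrangements_def)
qed

text \<open>Vertex by vertex, the outgoing arcs are permuted and equal arcs are indistinguishable.
  The induction removes the first arc: each possible \<open>a\<close> contributes in proportion to
  \<open>count E a\<close>, and these counts add up to the outdegree of the smallest vertex.\<close>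

lemma card_sorted_arrangements:
  assumes "finite V" "fst ` set_mset E \<subseteq> V"
  shows "card (sorted_arrangements E) * mult_fact E = (\<Prod>i\<in>V. fact (outdeg E i))"
  using assms(2)
proof (induction "size E" arbitrary: E)
  case 0
  then have "sorted_arrangements E = {[]}"
    by (auto simp: sorted_arrangements_def)
  then show ?case
    using 0 by (simp add: mult_fact_def)
next
  case (Suc s)
  define k where "k = Min (fst ` set_mset E)"
  let ?A = "{a \<in> set_mset E. fst a = k}"
  \<comment> \<open>The product of outdegree factorials after one arc leaving \<open>k\<close> is
    removed; it does not depend on which arc that is.\<close>
  define X :: nat where "X = fact (outdeg E k - 1) * (\<Prod>i\<in>V - {k}. fact (outdeg E i))"
  have ne: "E \<noteq> {#}"
    using Suc.hyps(2) by auto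
  have "k \<in> fst ` set_mset E"
    unfolding k_def using ne by (intro Min_in) auto
  then have kV: "k \<in> V"
    using Suc.prems by blast
  have step: "card (sorted_arrangements (E - {#a#})) * mult_fact E = count E a * X" if a: "a \<in> ?A" for a
  proof -
    obtain D where D: "E = add_mset a D"
      using a by (auto dest: multi_member_split)
    have "card (sorted_arrangements D) * mult_fact D = (\<Prod>i\<in>V. fact (outdeg D i))"
      using Suc D by (intro Suc.hyps(1)) auto
    also have "\<dots> = fact (outdeg D k) * (\<Prod>i\<in>V - {k}. fact (outdeg D i))"
      using assms(1) kV by (rule prod.remove)
    also have "\<dots> = X"
      unfolding X_def using a D by (auto intro!: prod.cong)
    finally show ?thesis
      using D by (simp add: mult_fact_add_mset algebra_simps)
  qed
  have "card (sorted_arrangements E) = (\<Sum>a\<in>?A. card ((#) a ` sorted_arrangements (E - {#a#})))"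
    unfolding sorted_arrangements_eq[OF ne] k_def [symmetric]
    by (intro card_UN_disjoint) auto
  also have "\<dots> = (\<Sum>a\<in>?A. card (sorted_arrangements (E - {#a#})))"
    by (intro sum.cong refl card_image) simp
  finally have "card (sorted_arrangements E) * mult_fact E = (\<Sum>a\<in>?A. count E a * X)"
    by (simp add: sum_distrib_right step)
  also have "\<dots> = (\<Sum>a\<in>?A. count E a) * X"
    by (simp add: sum_distrib_right)
  also have "(\<Sum>a\<in>?A. count E a) = outdeg E k"
    by (auto simp: outdeg_def size_multiset_overloaded_eq intro!: sum.cong)
  also have "outdeg E k * X = (\<Prod>i\<in>V. fact (outdeg E i))"
  proof -
    \<comment> \<open>Positivity matters because \<open>outdeg E k - 1\<close> is a truncated
      subtraction.\<close>
    have "outdeg E k > 0"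
      using \<open>k \<in> fst ` set_mset E\<close> by (auto dest!: multi_member_split)
    then have "outdeg E k * fact (outdeg E k - 1) = (fact (outdeg E k) :: nat)"
      by (simp add: fact_reduce)
    then have "outdeg E k * X = fact (outdeg E k) * (\<Prod>i\<in>V - {k}. fact (outdeg E i))"
      unfolding X_def by (metis mult.assoc)
    then show ?thesis
      by (simp only: prod.remove[OF assms(1) kV, of "\<lambda>i. fact (outdeg E i)"])
  qed
  finally show ?case .
qed

section \<open>Cutting arc lists into blocks of equal length\<close>

lemma inj_on_arc_list:
  assumes "r > 0"
  shows "inj_on arc_list {F. \<forall>x\<in>set F. length (snd x) = r}"
proof (rule inj_onI)
  fix F G
  assume "F \<in> {F. \<forall>x\<in>set F. length (snd x) = r}" "G \<in> {F. \<forall>x\<in>set F. length (snd x) = r}"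
    "arc_list F = arc_list G"
  then show "F = G"
  \<comment> \<open>Equal block lengths put the first cut at the same place in both lists, and a
    nonempty block shows its initial vertex.\<close>
  proof (induction F arbitrary: G)
    case Nil
    then show ?case
      using assms by (cases G) auto
  next
    case (Cons x F)
    then obtain y G' where G: "G = y # G'"
      using assms by (cases G) auto
    have eq: "map (Pair (fst x)) (snd x) = map (Pair (fst y)) (snd y)" "arc_list F = arc_list G'"
      using Cons.prems G by (auto simp: append_eq_append_conv)
    have "map fst (map (Pair (fst x)) (snd x)) = map fst (map (Pair (fst y)) (snd y))"
      "map snd (map (Pair (fst x)) (snd x)) = map snd (map (Pair (fst y)) (snd y))"
      using eq(1) by simp_all
    then have "fst x = fst y" "snd x = snd y"
      using assms Cons.prems G by (cases "snd x"; cases "snd y"; auto simp: comp_def)+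
    then show ?case
      using Cons eq(2) G by (auto simp: prod_eq_iff)
  qed
qed

text \<open>An empty block would lose its initial vertex in the arc list; nonempty blocks keep all
  of them.\<close>

lemma ball_fst_arc_list:
  assumes "\<forall>x\<in>set F. snd x \<noteq> []"
  shows "(\<forall>z\<in>set (arc_list F). P (fst z)) \<longleftrightarrow> (\<forall>z\<in>set F. P (fst z))"
  using assms by (induction F) (simp_all add: ball_Un ex_in_conv)

lemma sorted_arc_list:
  assumes "\<forall>x\<in>set F. snd x \<noteq> []"
  shows "sorted (map fst (arc_list F)) \<longleftrightarrow> sorted (map fst F)"
  using assms
proof (induction F)
  case (Cons x F)
  have "sorted (map (\<lambda>_. fst x) (snd x))"
    by (simp add: map_replicate_const)
  then show ?case
    using Cons ball_fst_arc_list[of F "(\<le>) (fst x)"]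
    by (auto simp: sorted_append comp_def ex_in_conv)
qed simp

text \<open>
  As the outdegree of the smallest vertex is a positive multiple of \<open>r\<close>, the first \<open>r\<close> arcs of a
  sorted list leave the same vertex, and splitting them off preserves the hypothesis.
\<close>

lemma arc_list_surj:
  assumes "r > 0" "sorted (map fst L)" "\<And>i. r dvd outdeg (mset L) i"
  shows "\<exists>F. arc_list F = L \<and> (\<forall>x\<in>set F. length (snd x) = r)"
  using assms(2,3)
proof (induction L rule: length_induct)
  case (1 L)
  show ?case
  proof (cases L)
    case Nil
    then show ?thesis
      by (intro exI[of _ "[]"]) simp
  next
    case (Cons a L')
    define k where "k = fst a"
    let ?P = "filter (\<lambda>x. fst x = k) L" and ?Q = "filter (\<lambda>x. fst x \<noteq> k) L"
    have L: "L = ?P @ ?Q"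
      by (rule sorted_key_split) (use 1 Cons in \<open>auto simp: k_def\<close>)
    have "outdeg (mset L) k > 0"
      by (simp add: Cons k_def)
    then have "r \<le> length ?P"
      using 1(3)[of k] by (simp add: outdeg_mset dvd_imp_le)
    then have take: "take r L = take r ?P"
      by (subst L) simp
    have fsts: "fst x = k" if "x \<in> set (take r L)" for x
      using that unfolding take by (auto dest: in_set_takeD)
    have len: "length (take r L) = r"
      using \<open>r \<le> length ?P\<close> by (simp add: take)
    have "r dvd outdeg (mset (drop r L)) i" for i
    proof -
      have "outdeg (mset L) i = outdeg (mset (take r L @ drop r L)) i"
        by simp
      also have "\<dots> = outdeg (mset (take r L)) i + outdeg (mset (drop r L)) i"
        unfolding outdeg_mset by (simp del: append_take_drop_id)
      finally have "outdeg (mset L) i = outdeg (mset (take r L)) i + outdeg (mset (drop r L)) i" .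
      moreover have "filter (\<lambda>x. fst x = i) (take r L) = (if i = k then take r L else [])"
        using fsts by (auto simp: filter_id_conv filter_empty_conv)
      then have "r dvd outdeg (mset (take r L)) i"
        using len by (simp add: outdeg_mset)
      ultimately show ?thesis
        using 1(3)[of i] by (simp add: dvd_add_right_iff)
    qed
    moreover have "sorted (map fst (drop r L))"
      using 1(2) by (simp add: sorted_wrt_drop flip: drop_map)
    moreover have "length (drop r L) < length L"
      using assms(1) Cons by simp
    ultimately obtain F where F: "arc_list F = drop r L" "\<forall>x\<in>set F. length (snd x) = r"
      using 1(1) by blast
    have "map (Pair k) (map snd (take r L)) = take r L"
      using fsts by (auto simp: comp_def intro!: map_idI prod_eqI)
    then have "arc_list ((k, map snd (take r L)) # F) = L"
      using F(1) by simp
    then show ?thesis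
      using F(2) len by (intro exI[of _ "(k, map snd (take r L)) # F"]) simp
  qed
qed

lemma length_arc_list:
  assumes "\<forall>x\<in>set F. length (snd x) = r"
  shows "length (arc_list F) = length F * r"
  using assms by (induction F) simp_all

text \<open>The inverse cuts a sorted arrangement into blocks of \<open>m - 1\<close> arcs. The
  divisibility of the outdegrees ensures that no block mixes two initial vertices.\<close>

lemma bij_betw_arc_list:
  assumes "m \<ge> 2" "E \<in> arc_multisets d (m - 1) n"
  shows "bij_betw arc_list (index_seqs_of m n d E) (sorted_arrangements E)"
proof (rule bij_betw_imageI)
  let ?r = "m - 1"
  have r: "?r > 0"
    using assms(1) by simp
  have sub: "index_seqs_of m n d E \<subseteq> {F. \<forall>x\<in>set F. length (snd x) = ?r}"
    by (auto simp: index_seqs_of_def index_seqs_def multi_indices_def)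
  show "inj_on arc_list (index_seqs_of m n d E)"
    using inj_on_arc_list[OF r] sub by (rule inj_on_subset)
  have "arc_list F \<in> sorted_arrangements E" if F: "F \<in> index_seqs_of m n d E" for F
  proof -
    have "\<forall>x\<in>set F. snd x \<noteq> []"
      using F sub r by fastforce
    then show ?thesis
      using F by (simp add: sorted_arrangements_def sorted_arc_list mset_arc_list
          index_seqs_of_def index_seqs_def)
  qed
  moreover have "L \<in> arc_list ` index_seqs_of m n d E" if L: "L \<in> sorted_arrangements E" for L
  proof -
    have E: "set L \<subseteq> {1..n} \<times> {1..n}" "length L = d * ?r" "mset L = E"
      using assms(2) L by (auto simp: arc_multisets_def sorted_arrangements_def)
    \<comment> \<open>\<open>arc_multisets\<close> gives divisibility on \<open>{1..n}\<close>; any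
      other vertex has outdegree 0.\<close>
    have "?r dvd outdeg (mset L) i" for i
    proof (cases "i \<in> {1..n}")
      case True
      then have "?r dvd outdeg E i"
        using assms(2) unfolding arc_multisets_def by blast
      then show ?thesis
        using E(3) by simp
    next
      case False
      then have "filter (\<lambda>x. fst x = i) L = []"
        using E(1) by (auto simp: filter_empty_conv)
      then show ?thesis
        by (simp add: outdeg_mset)
    qed
    then obtain F where F: "arc_list F = L" "\<forall>x\<in>set F. length (snd x) = ?r"
      using arc_list_surj[OF r, of L] L by (auto simp: sorted_arrangements_def)
    have ne: "\<forall>x\<in>set F. snd x \<noteq> []"
      using F(2) r by fastforce
    have "length F = d"
      using length_arc_list[OF F(2)] F(1) E(2) r by simp
    moreover have "sorted (map fst F)"
      using sorted_arc_list[OF ne] F(1) L by (simp add: sorted_arrangements_def)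
    moreover have "x \<in> {1..n} \<times> multi_indices ?r n" if x: "x \<in> set F" for x
    proof -
      have "(fst x, v) \<in> {1..n} \<times> {1..n}" if "v \<in> set (snd x)" for v
      proof -
        have "(fst x, v) \<in> set (arc_list F)"
          using x that by (force simp: set_arc_list)
        then show ?thesis
          using E(1) F(1) by blast
      qed
      \<comment> \<open>A witness that the block contains an arc, so that \<open>fst x\<close> lies
        in \<open>{1..n}\<close> as well.\<close>
      moreover have "hd (snd x) \<in> set (snd x)"
        using ne x by simp
      ultimately show ?thesis
        using F(2) x by (auto simp: multi_indices_def mem_Times_iff)
    qed
    ultimately have "F \<in> index_seqs_of m n d E"
      using E(3) F(1) mset_arc_list[of F] by (auto simp: index_seqs_of_def index_seqs_def)
    then show ?thesis
      using F(1) by blast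
  qed
  ultimately show "arc_list ` index_seqs_of m n d E = sorted_arrangements E"
    by blast
qed

lemma mult_fact_eq_b_arcs: "mult_fact E = b_arcs E"
  by (simp add: mult_fact_def b_arcs_def)

lemma card_index_seqs_of:
  assumes "m \<ge> 2" "E \<in> arc_multisets d (m - 1) n"
  shows "card (index_seqs_of m n d E) * b_arcs E = c_arcs n E"
proof -
  have "fst ` set_mset E \<subseteq> {1..n}"
    using assms(2) by (auto simp: arc_multisets_def)
  then show ?thesis
    using card_sorted_arrangements[of "{1..n}" E] bij_betw_same_card[OF bij_betw_arc_list[OF assms]]
    by (simp add: c_arcs_def mult_fact_eq_b_arcs)
qed

section \<open>The trace formula\<close>

text \<open>The initial vertices of the arcs form the list \<open>w\<close> and the terminal ones
  its rotation, so both have the same multiset.\<close>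

lemma closed_walks_balanced:
  assumes "w \<in> closed_walks n E"
  shows "outdeg E i = indeg E i"
proof -
  let ?z = "zip w (rotate1 w)"
  have E: "E = mset ?z"
    using assms by (simp add: closed_walks_def walk_arcs_def)
  have "outdeg E i = count (mset (map fst ?z)) i" "indeg E i = count (mset (map snd ?z)) i"
    by (simp_all only: E outdeg_def indeg_def count_mset count_list_eq_length_filter filter_map
        length_map comp_def size_mset eq_commute[of i] flip: mset_filter)
  moreover have "mset (rotate1 w) = mset w"
    by (cases w) simp_all
  ultimately show ?thesis
    by simp
qed

lemma row_count_Nil [simp]: "row_count [] i = 0"
  and row_count_Cons [simp]: "row_count (x # F) i = (if i = fst x then 1 else 0) + row_count F i"
  by (simp_all add: row_count_def)

text \<open>Each entry of \<open>F\<close> in row \<open>i\<close> contributes \<open>r\<close> arcs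
  leaving \<open>i\<close>. This turns (d_i(m-1))! into the factorial of an outdegree and also
  yields the divisibility condition.\<close>

lemma outdeg_seq_arcs:
  assumes "set F \<subseteq> A \<times> multi_indices r n"
  shows "outdeg (seq_arcs F) i = row_count F i * r"
  using assms
proof (induction F)
  case (Cons x F)
  have "length (filter (\<lambda>a. fst a = i) (map (Pair (fst x)) (snd x))) = (if i = fst x then r else 0)"
    using Cons.prems by (auto simp: multi_indices_def filter_map comp_def)
  then show ?case
    using Cons by (simp add: outdeg_mset algebra_simps del: mset_append mset_map flip: mset_arc_list)
qed (simp add: seq_arcs_def)

section \<open>Finiteness and regrouping of the sums\<close>

lemma finite_index_seqs [simp]: "finite (index_seqs m n d)"
  by (rule finite_subset[OF _ finite_lists_length_eq[of "{1..n} \<times> multi_indices (m - 1) n" d]])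
     (auto simp: index_seqs_def)

lemma finite_arc_multisets [simp]: "finite (arc_multisets d r n)"
proof (rule finite_subset)
  show "arc_multisets d r n \<subseteq> mset ` {L. set L \<subseteq> {1..n} \<times> {1..n} \<and> length L = d * r}"
  proof
    fix E assume "E \<in> arc_multisets d r n"
    moreover obtain L where "mset L = E"
      using ex_mset by blast
    ultimately show "E \<in> mset ` {L. set L \<subseteq> {1..n} \<times> {1..n} \<and> length L = d * r}"
      by (auto simp: arc_multisets_def)
  qed
qed (simp add: finite_lists_length_eq)

lemma finite_compositions [simp]: "finite (compositions n d)"
proof (rule finite_subset)
  show "compositions n d \<subseteq> {1..n} \<rightarrow>\<^sub>E {..d}"
  proof
    fix e assume "e \<in> compositions n d"
    then have e: "e \<in> {1..n} \<rightarrow>\<^sub>E UNIV" "sum e {1..n} = d"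
      by (auto simp: compositions_def)
    have "e i \<le> d" if "i \<in> {1..n}" for i
      using member_le_sum[of i "{1..n}" e] that e(2) by simp
    then show "e \<in> {1..n} \<rightarrow>\<^sub>E {..d}"
      using e(1) by (auto simp: PiE_iff)
  qed
qed (simp add: finite_PiE)

lemma sum_row_count:
  assumes "set F \<subseteq> A \<times> M" "finite A"
  shows "(\<Sum>i\<in>A. row_count F i) = length F"
  using assms(1)
proof (induction F)
  case (Cons x F)
  then show ?case
    using assms(2) by (auto simp: sum.distrib)
qed simp

text \<open>The row counts add up to the length, which is therefore \<open>d\<close>. The sets on
  the right are the fibres of a map to compositions; \<open>restrict\<close> matches their
  extensional encoding.\<close>

lemma block_seqs_eq_index_seqs:
  assumes "e \<in> compositions n d"
  shows "block_seqs (multi_indices (m - 1) n) e [1..<Suc n] =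
    {F \<in> index_seqs m n d. restrict (row_count F) {1..n} = e}"
proof -
  have e: "e \<in> extensional {1..n}" "sum e {1..n} = d"
    using assms by (auto simp: compositions_def PiE_def)
  have set_upt: "set [1..<Suc n] = {1..n}"
    by auto
  have counts: "(\<forall>i\<in>{1..n}. row_count F i = e i) \<longleftrightarrow> restrict (row_count F) {1..n} = e" for F
    using e(1) by (auto simp: fun_eq_iff extensional_def)
  have "length F = d" if "restrict (row_count F) {1..n} = e" "set F \<subseteq> {1..n} \<times> multi_indices (m - 1) n" for F
    using that e(2) sum_row_count[OF that(2)] counts[of F] by simp
  then show ?thesis
    unfolding block_seqs_def index_seqs_def set_upt counts by blast
qed

lemma product_operator_trace:
  assumes "m \<ge> 2" "d \<ge> 1" "e \<in> compositions n d"
  shows "product_operator m n T e (mat_trace (generic_mat n ^\<^sub>m (d * (m - 1)))) =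
    (\<Sum>F | F \<in> index_seqs m n d \<and> restrict (row_count F) {1..n} = e.
      Const (of_nat (b_arcs (seq_arcs F)) / of_nat (c_arcs n (seq_arcs F)) * pi_seq T F *
        of_nat (card (closed_walks n (seq_arcs F)))))"
proof -
  let ?P = "mat_trace (generic_mat n ^\<^sub>m (d * (m - 1)))"
  let ?c = "\<Prod>i\<leftarrow>[1..<Suc n]. 1 / fact (e i * (m - 1)) :: complex"
  have "product_operator m n T e ?P = Const ?c *
    (\<Sum>F | F \<in> index_seqs m n d \<and> restrict (row_count F) {1..n} = e.
      Const (pi_seq T F) * pdiffs (arc_list F) ?P)"
    unfolding product_operator_def
    by (subst product_operator_expansion)
       (simp_all only: sorted_wrt_upt block_seqs_eq_index_seqs[OF assms(3)])
  also have "\<dots> = (\<Sum>F | F \<in> index_seqs m n d \<and> restrict (row_count F) {1..n} = e.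
      Const ?c * (Const (pi_seq T F) * pdiffs (arc_list F) ?P))"
    by (rule sum_distrib_left)
  also have "\<dots> = (\<Sum>F | F \<in> index_seqs m n d \<and> restrict (row_count F) {1..n} = e.
      Const (of_nat (b_arcs (seq_arcs F)) / of_nat (c_arcs n (seq_arcs F)) * pi_seq T F *
        of_nat (card (closed_walks n (seq_arcs F)))))"
  proof (rule sum.cong[OF refl])
    fix F assume "F \<in> {F. F \<in> index_seqs m n d \<and> restrict (row_count F) {1..n} = e}"
    then have F: "set F \<subseteq> {1..n} \<times> multi_indices (m - 1) n" "length F = d"
        and e: "restrict (row_count F) {1..n} = e"
      by (auto simp: index_seqs_def)
    have "?c = (\<Prod>i\<in>set [1..<Suc n]. 1 / fact (e i * (m - 1)))"
      by (rule prod.distinct_set_conv_list [symmetric]) simp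
    also have "\<dots> = (\<Prod>i\<in>{1..n}. 1 / fact (e i * (m - 1)))"
      by (rule prod.cong) auto
    also have "\<dots> = (\<Prod>i\<in>{1..n}. 1 / fact (outdeg (seq_arcs F) i))"
      using outdeg_seq_arcs[OF F(1)] by (intro prod.cong refl) (simp flip: e)
    also have "\<dots> = 1 / of_nat (c_arcs n (seq_arcs F))"
      by (simp add: c_arcs_def prod_dividef)
    finally have c: "?c = 1 / of_nat (c_arcs n (seq_arcs F))" .
    have len: "length (arc_list F) = d * (m - 1)"
      using F by (subst length_arc_list[of F "m - 1"]) (auto simp: multi_indices_def)
    have "pdiffs (arc_list F) ?P = Const (of_nat (b_arcs (seq_arcs F)) *
        of_nat (card (closed_walks n (seq_arcs F))))"
      using pdiffs_trace[of "arc_list F" n] assms(1,2) len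
      by (simp add: mset_arc_list mult_fact_eq_b_arcs)
    then show "Const ?c * (Const (pi_seq T F) * pdiffs (arc_list F) ?P) =
      Const (of_nat (b_arcs (seq_arcs F)) / of_nat (c_arcs n (seq_arcs F)) * pi_seq T F *
        of_nat (card (closed_walks n (seq_arcs F))))"
      unfolding c by (simp add: Const_mult mult_ac)
  qed
  finally show ?thesis .
qed

text \<open>Size and divisibility come from the block structure of \<open>F\<close>, balance from
  the closed walk. Hence every other \<open>F\<close> has weight 0 in the trace.\<close>

lemma seq_arcs_in_arc_multisets:
  assumes "F \<in> index_seqs m n d" "closed_walks n (seq_arcs F) \<noteq> {}"
  shows "seq_arcs F \<in> arc_multisets d (m - 1) n"
proof -
  have F: "set F \<subseteq> {1..n} \<times> multi_indices (m - 1) n" "length F = d"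
    using assms(1) by (auto simp: index_seqs_def)
  have "set (arc_list F) \<subseteq> {1..n} \<times> {1..n}"
    using F(1) by (fastforce simp: set_arc_list multi_indices_def)
  then have "set_mset (seq_arcs F) \<subseteq> {1..n} \<times> {1..n}"
    by (simp flip: mset_arc_list)
  moreover have "length (arc_list F) = d * (m - 1)"
    using F by (subst length_arc_list[of F "m - 1"]) (auto simp: multi_indices_def)
  then have "size (seq_arcs F) = d * (m - 1)"
    by (simp flip: mset_arc_list)
  moreover have "outdeg (seq_arcs F) i = indeg (seq_arcs F) i" for i
    using assms(2) closed_walks_balanced by blast
  moreover have "m - 1 dvd outdeg (seq_arcs F) i" for i
    by (simp only: outdeg_seq_arcs[OF F(1)] dvd_triv_right)
  ultimately show ?thesis
    unfolding arc_multisets_def by blast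
qed

lemma Tr_eq:
  assumes "m \<ge> 2" "d \<ge> 1"
  shows "Tr m n d T = Const (of_nat (m - 1) ^ (n - 1) *
           (\<Sum>E\<in>arc_multisets d (m - 1) n.
              of_nat (b_arcs E) / of_nat (c_arcs n E) * pi_sum m n d T E *
              of_nat (card (closed_walks n E))))"
proof -
  let ?I = "index_seqs m n d" and ?A = "arc_multisets d (m - 1) n"
  define h where "h F = of_nat (b_arcs (seq_arcs F)) / of_nat (c_arcs n (seq_arcs F)) * pi_seq T F *
        of_nat (card (closed_walks n (seq_arcs F)))" for F
  have comp: "restrict (row_count F) {1..n} \<in> compositions n d" if "F \<in> ?I" for F
    using that sum_row_count[of F "{1..n}" "multi_indices (m - 1) n"]
    by (auto simp: compositions_def index_seqs_def)
  have "(\<Sum>e\<in>compositions n d. product_operator m n T e (mat_trace (generic_mat n ^\<^sub>m (d * (m - 1)))))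
      = (\<Sum>e\<in>compositions n d. \<Sum>F | F \<in> ?I \<and> restrict (row_count F) {1..n} = e. Const (h F))"
    using product_operator_trace[OF assms] by (intro sum.cong refl) (simp only: h_def)
  \<comment> \<open>Each \<open>F\<close> belongs to exactly one composition, given by its row
    counts.\<close>
  also have "\<dots> = (\<Sum>F\<in>?I. Const (h F))"
    using comp by (intro sum.group) auto
  also have "\<dots> = Const (\<Sum>F\<in>?I. h F)"
    by (rule Const_sum [symmetric])
  also have "(\<Sum>F\<in>?I. h F) = (\<Sum>F | F \<in> ?I \<and> seq_arcs F \<in> ?A. h F)"
  proof (rule sum.mono_neutral_right)
    have "h F = 0" if "F \<in> ?I" "seq_arcs F \<notin> ?A" for F
    proof -
      have "closed_walks n (seq_arcs F) = {}"
        using seq_arcs_in_arc_multisets[OF that(1)] that(2) by blast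
      then show ?thesis
        by (simp add: h_def)
    qed
    then show "\<forall>F\<in>?I - {F. F \<in> ?I \<and> seq_arcs F \<in> ?A}. h F = 0"
      by blast
  qed auto
  also have "\<dots> = (\<Sum>E\<in>?A. \<Sum>F | F \<in> {F. F \<in> ?I \<and> seq_arcs F \<in> ?A} \<and> seq_arcs F = E. h F)"
    by (rule sum.group [symmetric]) auto
  also have "\<dots> = (\<Sum>E\<in>?A. \<Sum>F\<in>index_seqs_of m n d E.
      of_nat (b_arcs E) / of_nat (c_arcs n E) * pi_seq T F * of_nat (card (closed_walks n E)))"
    by (intro sum.cong refl) (auto simp: h_def index_seqs_of_def)
  also have "\<dots> = (\<Sum>E\<in>?A. of_nat (b_arcs E) / of_nat (c_arcs n E) * pi_sum m n d T E *
              of_nat (card (closed_walks n E)))"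
    by (simp only: pi_sum_def sum_distrib_left sum_distrib_right)
  finally show ?thesis
    by (simp only: Tr_def Const_mult)
qed

text \<open>By \<open>card_index_seqs_of\<close>, c(E) is b(E) times the number of index sequences;
  the nonzero factor b(E) cancels.\<close>

lemma pi_avg_eq:
  assumes "m \<ge> 2" "E \<in> arc_multisets d (m - 1) n"
  shows "pi_avg m n d T E = of_nat (b_arcs E) / of_nat (c_arcs n E) * pi_sum m n d T E"
proof -
  have "b_arcs E \<noteq> 0"
    by (simp add: b_arcs_def)
  then show ?thesis
    by (simp add: pi_avg_def flip: card_index_seqs_of[OF assms])
qed

theorem theorem3p1:
  fixes m n d :: nat and T :: tensor
  assumes "m \<ge> 2" and "n \<ge> 1" and "d \<ge> 1"
  shows "Tr m n d T = Const (of_nat (m - 1) ^ (n - 1) *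
           (\<Sum>E\<in>arc_multisets d (m - 1) n.
              of_nat (b_arcs E) / of_nat (c_arcs n E) * pi_sum m n d T E *
              of_nat (card (closed_walks n E)))) \<and>
         Tr m n d T = Const (of_nat (m - 1) ^ (n - 1) *
           (\<Sum>E\<in>arc_multisets d (m - 1) n.
              pi_avg m n d T E * of_nat (card (closed_walks n E))))"
  using Tr_eq[OF assms(1,3)] pi_avg_eq[OF assms(1)] by simp

end
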